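(* Let $n\in\mathbb{N}$, let $\mathbb{X}=\ell_1^n$ (over $\mathbb{R}$) and $T\in S_{\mathbb{L}(\mathbb{X},\mathbb{X})}$. Then $T$ is an isometry if and only if there exists $\epsilon_0>0$ such that for each $0<\epsilon<\epsilon_0$, $T$ is the only uniform $\epsilon$-BPB approximation of $T$. Moreover, for every $n\in\mathbb{N}$ the pair $(\ell_1^n,\ell_1^n)$ has the non-trivial norm preserving uniform BPB approximation property.
   Context: $\mathbb{L}(\mathbb{X},\mathbb{Y})$ is the space of bounded linear operators with the operator norm; $S_Z$ is the unit sphere of a normed space $Z$; $\mathrm{Iso}(\mathbb{X},\mathbb{Y})$ is the (possibly empty) set of linear isometries from $\mathbb{X}$ to $\mathbb{Y}$. For $A\in\mathbb{L}(\mathbb{X},\mathbb{Y})$, $M_A=\{x\in S_{\mathbb{X}}:\|Ax\|=\|A\|\}$. For $T\in S_{\mathbb{L}(\mathbb{X},\mathbb{Y})}$ and $\epsilon>0$, an operator $A\in S_{\mathbb{L}(\mathbb{X},\mathbb{Y})}$ is a uniform $\epsilon$-BPB approximation of $T$ if $\|T-A\|<\epsilon$ and there exists $\delta(\epsilon)>0$ such that for each $x_0\in S_{\mathbb{X}}$ with $\|Tx_0\|>1-\delta(\epsilon)$ there exists $u_0\in M_A$ with $\|u_0-x_0\|<\epsilon$. It is non-trivial if in addition $A\neq T$. The pair $(\mathbb{X},\mathbb{Y})$ has the non-trivial norm preserving uniform BPB approximation property if for every $T\in S_{\mathbb{L}(\mathbb{X},\mathbb{Y})}\setminus\mathrm{Iso}(\mathbb{X},\mathbb{Y})$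 and every $\epsilon>0$, $T$ admits a non-trivial uniform $\epsilon$-BPB approximation $A_\epsilon$ with $M_T=M_{A_\epsilon}$. *)

theory Defs
  imports "HOL-Analysis.Analysis" "HOL-Analysis.Finite_Function_Topology"
begin

text \<open>
  The real space \<open>\<ell>\<^sub>1\<^sup>n\<close>, with \<open>n = CARD('n)\<close>: the library norm of \<open>'n \<Rightarrow>\<^sub>0 real\<close> is the sum
  of the absolute values of the coordinates.  The index type \<open>'n\<close> is meant to be finite; a type
  synonym cannot carry that sort constraint, so it has to be imposed wherever the synonym is used.
\<close>

type_synonym 'n l1 = "'n \<Rightarrow>\<^sub>0 real"

lemma norm_l1: "norm x = (\<Sum>i\<in>UNIV. \<bar>Poly_Mapping.lookup x i\<bar>)" for x :: "'n::finite l1"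
proof -
  have "norm x = (\<Sum>i\<in>Poly_Mapping.keys x. \<bar>Poly_Mapping.lookup x i\<bar>)"
    by (simp add: norm_poly_mapping_def dist_poly_mapping_def)
  also have "\<dots> = (\<Sum>i\<in>UNIV. \<bar>Poly_Mapping.lookup x i\<bar>)"
    by (rule sum.mono_neutral_left) (auto simp: in_keys_iff)
  finally show ?thesis .
qed

lemma l1_coordinates_surj: "\<exists>x :: 'n::finite l1. Poly_Mapping.lookup x = f"
  by (intro exI[of _ "Abs_poly_mapping f"]) simp

definition Iso :: "('a::real_normed_vector \<Rightarrow>\<^sub>L 'b::real_normed_vector) set"
  where "Iso = {T. \<forall>x. norm (blinfun_apply T x) = norm x}"

definition norm_attain :: "('a::real_normed_vector \<Rightarrow>\<^sub>L 'b::real_normed_vector) \<Rightarrow> 'a set"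
  where "norm_attain A = {x \<in> sphere 0 1. norm (blinfun_apply A x) = norm A}"

definition uniform_BPB_approx ::
    "real \<Rightarrow> ('a::real_normed_vector \<Rightarrow>\<^sub>L 'b::real_normed_vector) \<Rightarrow> ('a \<Rightarrow>\<^sub>L 'b) \<Rightarrow> bool"
  where "uniform_BPB_approx \<epsilon> T A \<longleftrightarrow>
    \<epsilon> > 0 \<and> T \<in> sphere 0 1 \<and> A \<in> sphere 0 1 \<and> norm (T - A) < \<epsilon> \<and>
    (\<exists>\<delta>>0. \<forall>x\<^sub>0 \<in> sphere 0 1. norm (blinfun_apply T x\<^sub>0) > 1 - \<delta> \<longrightarrow>
       (\<exists>u\<^sub>0 \<in> norm_attain A. norm (u\<^sub>0 - x\<^sub>0) < \<epsilon>))"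

definition nontrivial_uniform_BPB_approx ::
    "real \<Rightarrow> ('a::real_normed_vector \<Rightarrow>\<^sub>L 'b::real_normed_vector) \<Rightarrow> ('a \<Rightarrow>\<^sub>L 'b) \<Rightarrow> bool"
  where "nontrivial_uniform_BPB_approx \<epsilon> T A \<longleftrightarrow> uniform_BPB_approx \<epsilon> T A \<and> A \<noteq> T"

text \<open>The pair of spaces is passed as a pair of types.\<close>

definition nontrivial_norm_preserving_uniform_BPB_property ::
    "'a::real_normed_vector itself \<Rightarrow> 'b::real_normed_vector itself \<Rightarrow> bool"
  where "nontrivial_norm_preserving_uniform_BPB_property _ _ \<longleftrightarrow>
    (\<forall>T \<in> sphere 0 1 - (Iso :: ('a \<Rightarrow>\<^sub>L 'b) set). \<forall>\<epsilon>>0.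
       \<exists>A. nontrivial_uniform_BPB_approx \<epsilon> T A \<and> norm_attain T = norm_attain A)"

end

theory Submission
  imports Defs
begin

text \<open>
  By the equality case of the triangle inequality, whether a norm-one operator \<open>T\<close> on \<open>\<ell>\<^sub>1\<^sup>n\<close>
  attains its norm at \<open>x\<close> depends only on which columns of its matrix have norm one and on the signs
  of the products of two entries in a common row.  If \<open>T\<close> is not an isometry, one column can be
  perturbed without changing these data: a column of norm less than one arbitrarily; otherwise, a
  small mass is moved within a unit column from a nonzero entry either to another nonzero entry or
  to a row that vanishes identically, and failing both, \<open>T\<close> is a signed permutation matrix.  By
  compactness of the sphere, every operator with the same norm attainment set as \<open>T\<close> and close to
  \<open>T\<close> is a uniform approximation.

  Conversely, if \<open>T\<close> is an isometry, the norm attainment set of an approximation is \<open>\<epsilon>\<close>-dense in the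
  sphere.  For \<open>\<epsilon> \<le> 1/n\<close> it meets every open orthant, so the columns are unit vectors with disjoint
  supports and all entries lie in \<open>{-1, 0, 1}\<close>.  Operators of this kind are at mutual distance at
  least one.
\<close>

section \<open>Equality in the triangle inequality for finite real sums\<close>

lemma sum_eq_sum_iff_of_le:
  fixes f g :: "'a \<Rightarrow> 'b::ordered_cancel_comm_monoid_add"
  assumes "finite A" "\<And>i. i \<in> A \<Longrightarrow> f i \<le> g i"
  shows "sum f A = sum g A \<longleftrightarrow> (\<forall>i\<in>A. f i = g i)"
  using sum_mono_inv[of f A g] assms by auto

text \<open>Nonnegative pairwise products mean that no two terms have strictly opposite signs, so
  all terms lie on one side of zero. The product form avoids choosing that side and is easy to
  compare between two operators.\<close>

lemma abs_sum_eq_sum_abs_iff: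
  fixes f :: "'a \<Rightarrow> real"
  assumes "finite A"
  shows "\<bar>sum f A\<bar> = (\<Sum>i\<in>A. \<bar>f i\<bar>) \<longleftrightarrow> (\<forall>i\<in>A. \<forall>j\<in>A. f i * f j \<ge> 0)"
proof
  assume eq: "\<bar>sum f A\<bar> = (\<Sum>i\<in>A. \<bar>f i\<bar>)"
  show "\<forall>i\<in>A. \<forall>j\<in>A. f i * f j \<ge> 0"
  proof (cases "sum f A \<ge> 0")
    case True
    with eq have "(\<Sum>i\<in>A. f i) = (\<Sum>i\<in>A. \<bar>f i\<bar>)" by simp
    then have "\<forall>i\<in>A. f i = \<bar>f i\<bar>"
      by (subst (asm) sum_eq_sum_iff_of_le) (use assms in auto)
    then have "\<forall>i\<in>A. f i \<ge> 0" by (metis abs_ge_zero)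
    then show ?thesis by simp
  next
    case False
    with eq have "(\<Sum>i\<in>A. - f i) = (\<Sum>i\<in>A. \<bar>f i\<bar>)" by (simp add: sum_negf)
    then have "\<forall>i\<in>A. - f i = \<bar>f i\<bar>"
      by (subst (asm) sum_eq_sum_iff_of_le) (use assms in auto)
    then have "\<forall>i\<in>A. f i \<le> 0" by (metis abs_ge_zero neg_0_le_iff_le)
    then show ?thesis by (simp add: mult_nonpos_nonpos)
  qed
next
  assume *: "\<forall>i\<in>A. \<forall>j\<in>A. f i * f j \<ge> 0"
  have "(\<forall>i\<in>A. f i \<ge> 0) \<or> (\<forall>i\<in>A. f i \<le> 0)"
    using * by (meson linorder_le_less_linear mult_pos_neg not_le order_less_le)
  then show "\<bar>sum f A\<bar> = (\<Sum>i\<in>A. \<bar>f i\<bar>)"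
  proof
    assume "\<forall>i\<in>A. f i \<ge> 0"
    then show ?thesis by (simp add: sum_nonneg)
  next
    assume "\<forall>i\<in>A. f i \<le> 0"
    then have "(\<Sum>i\<in>A. \<bar>f i\<bar>) = - sum f A" "sum f A \<le> 0"
      by (simp_all add: sum_negf[symmetric] sum_nonpos)
    then show ?thesis by simp
  qed
qed

section \<open>Coordinates and compactness of the sphere in l1\<close>

lemma lookup_scaleR [simp]:
  "Poly_Mapping.lookup (c *\<^sub>R x) i = c * Poly_Mapping.lookup x i" for x :: "'n::finite l1"
  by (simp add: scaleR_poly_mapping_def)

lemma norm_single [simp]: "norm (Poly_Mapping.single i c :: 'n::finite l1) = \<bar>c\<bar>"
proof -
  have "norm (Poly_Mapping.single i c :: 'n l1) = (\<Sum>k\<in>UNIV. if k = i then \<bar>c\<bar> else 0)"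
    unfolding norm_l1 by (intro sum.cong) (auto simp: lookup_single when_def)
  then show ?thesis by simp
qed

lemma abs_lookup_le_norm: "\<bar>Poly_Mapping.lookup x i\<bar> \<le> norm x" for x :: "'n::finite l1"
  unfolding norm_l1 by (rule member_le_sum) auto

lemma l1_expansion:
  "x = (\<Sum>i\<in>UNIV. Poly_Mapping.lookup x i *\<^sub>R Poly_Mapping.single i 1)" for x :: "'n::finite l1"
proof (rule poly_mapping_eqI)
  fix k
  have "(\<Sum>i\<in>UNIV. Poly_Mapping.lookup x i * Poly_Mapping.lookup (Poly_Mapping.single i (1::real)) k) =
      (\<Sum>i\<in>UNIV. if i = k then Poly_Mapping.lookup x k else 0)"
    by (intro sum.cong) (auto simp: lookup_single when_def)
  then show "Poly_Mapping.lookup x k =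
      Poly_Mapping.lookup (\<Sum>i\<in>UNIV. Poly_Mapping.lookup x i *\<^sub>R Poly_Mapping.single i 1) k"
    by (simp add: lookup_sum)
qed

text \<open>Compactness is transported from \<open>real^'n\<close>: the coordinate map is linear,
  hence continuous, and the preimage of the sphere is bounded because the Euclidean norm is at most
  the l1 norm.\<close>

lemma compact_sphere_l1: "compact (sphere (0 :: 'n::finite l1) 1)"
proof -
  define \<phi> :: "real^'n \<Rightarrow> 'n l1" where "\<phi> v = Abs_poly_mapping (\<lambda>i. v $ i)" for v
  have lookup_\<phi> [simp]: "Poly_Mapping.lookup (\<phi> v) i = v $ i" for v i
    by (simp add: \<phi>_def)
  have "linear \<phi>"
    by (rule linearI; rule poly_mapping_eqI) (simp_all add: lookup_add)
  then have cont: "continuous_on UNIV \<phi>"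
    by (simp add: linear_continuous_on linear_conv_bounded_linear)
  have "norm v \<le> norm (\<phi> v)" for v
    by (simp add: norm_l1 norm_le_l1_cart)
  then have "bounded {v. norm (\<phi> v) = 1}"
    by (intro boundedI[where B = 1]) (metis mem_Collect_eq)
  moreover have "closed {v. norm (\<phi> v) = 1}"
    by (intro closed_Collect_eq continuous_intros cont)
  ultimately have "compact {v. norm (\<phi> v) = 1}"
    by (simp add: compact_eq_bounded_closed)
  then have "compact (\<phi> ` {v. norm (\<phi> v) = 1})"
    using cont by (meson compact_continuous_image continuous_on_subset subset_UNIV)
  moreover have "\<phi> ` {v. norm (\<phi> v) = 1} = sphere 0 1"
  proof -
    have "x = \<phi> (\<chi> i. Poly_Mapping.lookup x i)" for x
      by (rule poly_mapping_eqI) simp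
    then show ?thesis by (auto simp: image_iff) metis
  qed
  ultimately show ?thesis by simp
qed

text \<open>The points of the sphere at distance at least \<open>\<epsilon>\<close> from all of
  \<open>norm_attain T\<close> form a compact set \<open>K\<close>. The norm of \<open>T x\<close>
  has a maximum below 1 on \<open>K\<close>, and the gap to 1 serves as \<open>\<delta>\<close>. The
  conclusion sees the approximating operator only through its norm attainment set, so it passes to
  every operator sharing that set.\<close>

lemma norm_attain_nearby:
  fixes T :: "'a::real_normed_vector \<Rightarrow>\<^sub>L 'b::real_normed_vector"
  assumes compact: "compact (sphere (0 :: 'a) 1)" and T: "norm T = 1" and "\<epsilon> > 0"
  shows "\<exists>\<delta>>0. \<forall>x \<in> sphere 0 1. norm (blinfun_apply T x) > 1 - \<delta> \<longrightarrow>
    (\<exists>u \<in> norm_attain T. norm (u - x) < \<epsilon>)"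
proof -
  define K where "K = sphere (0 :: 'a) 1 \<inter> (\<Inter>u\<in>norm_attain T. {x. \<epsilon> \<le> norm (u - x)})"
  have "compact K"
    unfolding K_def using compact
    by (intro compact_Int_closed closed_INT ballI closed_Collect_le continuous_intros) auto
  show ?thesis
  proof (cases "K = {}")
    case True
    \<comment> \<open>Every point of the sphere is already close to \<open>norm_attain T\<close>, so
      any positive \<open>\<delta>\<close> will do.\<close>
    then show ?thesis
      unfolding K_def by (intro exI[of _ 1]) (force simp: not_le)
  next
    case False
    have cont: "continuous_on K (\<lambda>x. norm (blinfun_apply T x))"
      by (intro continuous_intros)
    obtain y where y: "y \<in> K"
      and max: "\<And>x. x \<in> K \<Longrightarrow> norm (blinfun_apply T x) \<le> norm (blinfun_apply T y)"
      using continuous_attains_sup[OF \<open>compact K\<close> False cont] by auto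
    have "y \<notin> norm_attain T"
      using y \<open>\<epsilon> > 0\<close> by (auto simp: K_def)
    with y T have "norm (blinfun_apply T y) \<noteq> 1"
      by (auto simp: K_def norm_attain_def)
    moreover have "norm (blinfun_apply T y) \<le> 1"
      using norm_blinfun[of T y] y T by (simp add: K_def)
    ultimately have "1 - norm (blinfun_apply T y) > 0" by simp
    moreover have "\<exists>u \<in> norm_attain T. norm (u - x) < \<epsilon>"
      if "x \<in> sphere 0 1" "norm (blinfun_apply T x) > norm (blinfun_apply T y)" for x
      using max[of x] that by (fastforce simp: K_def not_le)
    ultimately show ?thesis
      by (intro exI[of _ "1 - norm (blinfun_apply T y)"]) auto
  qed
qed

section \<open>Matrix entries and the operator norm\<close>

text \<open>The row index comes first, as in the matrix of \<open>T\<close> for the standard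
  bases.\<close>

definition entry :: "('n l1 \<Rightarrow>\<^sub>L 'm l1) \<Rightarrow> 'm \<Rightarrow> 'n \<Rightarrow> real"
  where "entry T k j = Poly_Mapping.lookup (blinfun_apply T (Poly_Mapping.single j 1)) k"

lemma norm_column:
  "norm (blinfun_apply T (Poly_Mapping.single j 1)) = (\<Sum>k\<in>UNIV. \<bar>entry T k j\<bar>)"
  for T :: "'n::finite l1 \<Rightarrow>\<^sub>L 'm::finite l1"
  by (simp add: norm_l1 entry_def)

lemma lookup_blinfun_apply:
  "Poly_Mapping.lookup (blinfun_apply T x) k = (\<Sum>j\<in>UNIV. entry T k j * Poly_Mapping.lookup x j)"
  for T :: "'n::finite l1 \<Rightarrow>\<^sub>L 'm::finite l1"
proof -
  have "blinfun_apply T x =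
      (\<Sum>j\<in>UNIV. Poly_Mapping.lookup x j *\<^sub>R blinfun_apply T (Poly_Mapping.single j 1))"
    by (subst l1_expansion[of x]) (simp only: blinfun.sum_right blinfun.scaleR_right)
  then show ?thesis
    by (simp add: lookup_sum entry_def mult.commute)
qed

lemma entry_eqI:
  fixes T A :: "'n::finite l1 \<Rightarrow>\<^sub>L 'm::finite l1"
  assumes "\<And>k j. entry T k j = entry A k j"
  shows "T = A"
  by (intro blinfun_eqI poly_mapping_eqI) (simp add: lookup_blinfun_apply assms)

lemma norm_apply_le_columns:
  fixes T :: "'n::finite l1 \<Rightarrow>\<^sub>L 'm::finite l1"
  shows "norm (blinfun_apply T x) \<le>
    (\<Sum>j\<in>UNIV. \<bar>Poly_Mapping.lookup x j\<bar> * norm (blinfun_apply T (Poly_Mapping.single j 1)))"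
proof -
  have "norm (blinfun_apply T x) \<le>
      (\<Sum>j\<in>UNIV. norm (Poly_Mapping.lookup x j *\<^sub>R blinfun_apply T (Poly_Mapping.single j 1)))"
    by (subst l1_expansion[of x]) (simp only: blinfun.sum_right blinfun.scaleR_right norm_sum)
  then show ?thesis by simp
qed

lemma norm_le_one_columnsI:
  fixes T :: "'n::finite l1 \<Rightarrow>\<^sub>L 'm::finite l1"
  assumes "\<And>j. norm (blinfun_apply T (Poly_Mapping.single j 1)) \<le> 1"
  shows "norm T \<le> 1"
proof (rule norm_blinfun_bound)
  fix x
  have "norm (blinfun_apply T x) \<le> (\<Sum>j\<in>UNIV. \<bar>Poly_Mapping.lookup x j\<bar> * 1)"
    by (rule order_trans[OF norm_apply_le_columns], intro sum_mono mult_left_mono assms) auto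
  then show "norm (blinfun_apply T x) \<le> 1 * norm x"
    by (simp add: norm_l1)
qed simp

lemma norm_column_le:
  fixes T :: "'n::finite l1 \<Rightarrow>\<^sub>L 'm::finite l1"
  shows "norm (blinfun_apply T (Poly_Mapping.single j 1)) \<le> norm T"
  using norm_blinfun[of T "Poly_Mapping.single j 1"] by simp

text \<open>The operator norm on l1 is the largest column norm, and a maximum over finitely many
  columns is attained.\<close>

lemma unit_column_exists:
  fixes T :: "'n::finite l1 \<Rightarrow>\<^sub>L 'm::finite l1"
  assumes "norm T = 1"
  shows "\<exists>j. norm (blinfun_apply T (Poly_Mapping.single j 1)) = 1"
proof -
  define c where "c = (MAX j. norm (blinfun_apply T (Poly_Mapping.single j 1)))"
  have c: "norm (blinfun_apply T (Poly_Mapping.single j 1)) \<le> c" for j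
    unfolding c_def by (intro Max_ge) auto
  have "c \<in> range (\<lambda>j. norm (blinfun_apply T (Poly_Mapping.single j 1)))"
    unfolding c_def by (intro Max_in) auto
  then obtain j where j: "c = norm (blinfun_apply T (Poly_Mapping.single j 1))" by blast
  have "norm T \<le> c"
  proof (rule norm_blinfun_bound)
    fix x
    have "norm (blinfun_apply T x) \<le> (\<Sum>j\<in>UNIV. \<bar>Poly_Mapping.lookup x j\<bar> * c)"
      by (rule order_trans[OF norm_apply_le_columns], intro sum_mono mult_left_mono c) auto
    then show "norm (blinfun_apply T x) \<le> c * norm x"
      by (simp add: norm_l1 sum_distrib_left mult.commute)
  qed (simp add: j)
  then show ?thesis
    using j norm_column_le[of T j] assms by (intro exI[of _ j]) simp
qed

section \<open>The norm attainment set read off from the matrix\<close>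

text \<open>Two estimates bound the norm of \<open>T x\<close> by 1: the triangle inequality in each
  row, then column norms at most 1. Norm attainment means equality in both. Equality in the first
  says that no row has cancellation, equality in the second that \<open>x\<close> is supported on
  unit columns.\<close>

lemma norm_attain_iff:
  fixes T :: "'n::finite l1 \<Rightarrow>\<^sub>L 'm::finite l1"
  assumes T: "norm T = 1"
  shows "x \<in> norm_attain T \<longleftrightarrow> norm x = 1 \<and>
    (\<forall>j. Poly_Mapping.lookup x j \<noteq> 0 \<longrightarrow>
       norm (blinfun_apply T (Poly_Mapping.single j 1)) = 1) \<and>
    (\<forall>k i j. (entry T k i * Poly_Mapping.lookup x i) * (entry T k j * Poly_Mapping.lookup x j) \<ge> 0)"
    (is "_ \<longleftrightarrow> _ \<and> ?unit \<and> ?signs")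
proof (cases "norm x = 1")
  case True
  let ?f = "\<lambda>k j. entry T k j * Poly_Mapping.lookup x j"
  let ?c = "\<lambda>j. norm (blinfun_apply T (Poly_Mapping.single j 1))"
  let ?x = "\<lambda>j. \<bar>Poly_Mapping.lookup x j\<bar>"
  have c: "?c j \<le> 1" for j
    using norm_column_le[of T j] T by simp
  have norm_T: "norm (blinfun_apply T x) = (\<Sum>k\<in>UNIV. \<bar>\<Sum>j\<in>UNIV. ?f k j\<bar>)"
    by (simp add: norm_l1 lookup_blinfun_apply)
  \<comment> \<open>Exchanging the sums turns the bound by rows into a sum of column norms weighted
    by the coordinates of \<open>x\<close>.\<close>
  have swap: "(\<Sum>k\<in>UNIV. \<Sum>j\<in>UNIV. \<bar>?f k j\<bar>) = (\<Sum>j\<in>UNIV. ?c j * ?x j)"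
    by (subst sum.swap) (simp add: norm_column abs_mult sum_distrib_right)
  have le1: "(\<Sum>k\<in>UNIV. \<bar>\<Sum>j\<in>UNIV. ?f k j\<bar>) \<le> (\<Sum>k\<in>UNIV. \<Sum>j\<in>UNIV. \<bar>?f k j\<bar>)"
    by (intro sum_mono sum_abs)
  have le2: "(\<Sum>j\<in>UNIV. ?c j * ?x j) \<le> (\<Sum>j\<in>UNIV. ?x j)"
    by (intro sum_mono mult_left_le_one_le c) auto
  have one: "(\<Sum>j\<in>UNIV. ?x j) = 1"
    using True by (simp add: norm_l1)
  have signs: "(\<Sum>k\<in>UNIV. \<bar>\<Sum>j\<in>UNIV. ?f k j\<bar>) = (\<Sum>k\<in>UNIV. \<Sum>j\<in>UNIV. \<bar>?f k j\<bar>) \<longleftrightarrow> ?signs"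
  proof -
    have "(\<Sum>k\<in>UNIV. \<bar>\<Sum>j\<in>UNIV. ?f k j\<bar>) = (\<Sum>k\<in>UNIV. \<Sum>j\<in>UNIV. \<bar>?f k j\<bar>) \<longleftrightarrow>
        (\<forall>k. \<bar>\<Sum>j\<in>UNIV. ?f k j\<bar> = (\<Sum>j\<in>UNIV. \<bar>?f k j\<bar>))"
      by (subst sum_eq_sum_iff_of_le) auto
    then show ?thesis by (simp add: abs_sum_eq_sum_abs_iff)
  qed
  have unit: "(\<Sum>j\<in>UNIV. ?c j * ?x j) = (\<Sum>j\<in>UNIV. ?x j) \<longleftrightarrow> ?unit"
  proof -
    have "(\<Sum>j\<in>UNIV. ?c j * ?x j) = (\<Sum>j\<in>UNIV. ?x j) \<longleftrightarrow> (\<forall>j. ?c j * ?x j = ?x j)"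
      by (subst sum_eq_sum_iff_of_le) (auto intro: mult_left_le_one_le c)
    then show ?thesis by auto
  qed
  have "norm (blinfun_apply T x) = 1 \<longleftrightarrow> ?unit \<and> ?signs"
    unfolding signs[symmetric] unit[symmetric] norm_T using le1 le2 one swap by linarith
  then show ?thesis
    using True T by (simp add: norm_attain_def)
qed (simp add: norm_attain_def)

text \<open>Comparing signs for distinct unit columns suffices: for \<open>i = j\<close> the product
  is a square, and points of the attainment set vanish on the other columns.\<close>

lemma norm_attain_eqI:
  fixes T A :: "'n::finite l1 \<Rightarrow>\<^sub>L 'm::finite l1"
  assumes T: "norm T = 1" and A: "norm A = 1"
    and unit: "\<And>j. norm (blinfun_apply T (Poly_Mapping.single j 1)) = 1 \<longleftrightarrow>
      norm (blinfun_apply A (Poly_Mapping.single j 1)) = 1"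
    and sign: "\<And>k i j. i \<noteq> j \<Longrightarrow> norm (blinfun_apply T (Poly_Mapping.single i 1)) = 1 \<Longrightarrow>
      norm (blinfun_apply T (Poly_Mapping.single j 1)) = 1 \<Longrightarrow>
      sgn (entry T k i * entry T k j) = sgn (entry A k i * entry A k j)"
  shows "norm_attain T = norm_attain A"
proof (rule set_eqI)
  fix x
  have "(entry T k i * Poly_Mapping.lookup x i) * (entry T k j * Poly_Mapping.lookup x j) \<ge> 0 \<longleftrightarrow>
        (entry A k i * Poly_Mapping.lookup x i) * (entry A k j * Poly_Mapping.lookup x j) \<ge> 0"
    if supp: "\<forall>j. Poly_Mapping.lookup x j \<noteq> 0 \<longrightarrow>
      norm (blinfun_apply T (Poly_Mapping.single j 1)) = 1" for k i j
  proof (cases "i = j \<or> Poly_Mapping.lookup x i = 0 \<or> Poly_Mapping.lookup x j = 0")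
    case False
    then have "sgn (entry T k i * entry T k j) = sgn (entry A k i * entry A k j)"
      using supp by (intro sign) auto
    then have "sgn ((entry T k i * entry T k j) * (Poly_Mapping.lookup x i * Poly_Mapping.lookup x j)) =
      sgn ((entry A k i * entry A k j) * (Poly_Mapping.lookup x i * Poly_Mapping.lookup x j))"
      by (simp only: sgn_mult)
    then have "(entry T k i * entry T k j) * (Poly_Mapping.lookup x i * Poly_Mapping.lookup x j) \<ge> 0 \<longleftrightarrow>
      (entry A k i * entry A k j) * (Poly_Mapping.lookup x i * Poly_Mapping.lookup x j) \<ge> 0"
      by (metis zero_le_sgn_iff)
    then show ?thesis by (simp add: mult_ac)
  qed auto
  then show "x \<in> norm_attain T \<longleftrightarrow> x \<in> norm_attain A"
    unfolding norm_attain_iff[OF T] norm_attain_iff[OF A] by (metis unit)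
qed

section \<open>Perturbing a single column\<close>

text \<open>The perturbation is the operator \<open>P\<close> of rank at most one that multiplies
  \<open>v\<close> by the coordinate \<open>j\<close>; that coordinate is bounded by the
  norm.\<close>

lemma column_perturbation:
  fixes T :: "'n::finite l1 \<Rightarrow>\<^sub>L 'm::finite l1"
  obtains A where "norm (A - T) \<le> norm v"
    and "\<And>i. blinfun_apply A (Poly_Mapping.single i 1) =
      blinfun_apply T (Poly_Mapping.single i 1) + (if i = j then v else 0)"
proof -
  define P where "P = Blinfun (\<lambda>x :: 'n l1. Poly_Mapping.lookup x j *\<^sub>R v)"
  have "norm (Poly_Mapping.lookup x j *\<^sub>R v) \<le> norm x * norm v" for x :: "'n l1"
    by (simp add: abs_lookup_le_norm mult_right_mono)
  then have "bounded_linear (\<lambda>x :: 'n l1. Poly_Mapping.lookup x j *\<^sub>R v)"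
    by (intro bounded_linear_intro[where K = "norm v"])
      (simp_all add: lookup_add scaleR_left_distrib)
  then have P: "blinfun_apply P x = Poly_Mapping.lookup x j *\<^sub>R v" for x
    by (simp add: P_def bounded_linear_Blinfun_apply)
  have "norm P \<le> norm v"
    by (rule norm_blinfun_bound) (simp_all add: P mult.commute[of "norm v"] abs_lookup_le_norm mult_right_mono)
  then show ?thesis
    by (intro that[of "T + P"]) (simp_all add: blinfun.add_left P lookup_single when_def)
qed

text \<open>This reduces the search for an approximation to the choice of a vector \<open>v\<close>
  to add to column \<open>j\<close>. The set of unit columns is preserved and nonempty, which keeps
  the operator norm equal to 1.\<close>

lemma nontrivial_approx_exists:
  fixes T :: "'n::finite l1 \<Rightarrow>\<^sub>L 'm::finite l1"
  assumes T: "norm T = 1" and "\<epsilon> > 0" and "v \<noteq> 0" "norm v < \<epsilon>"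
    and le: "norm (blinfun_apply T (Poly_Mapping.single j 1) + v) \<le> 1"
    and unit: "norm (blinfun_apply T (Poly_Mapping.single j 1) + v) = 1 \<longleftrightarrow>
      norm (blinfun_apply T (Poly_Mapping.single j 1)) = 1"
    and sign: "\<And>k i. i \<noteq> j \<Longrightarrow> norm (blinfun_apply T (Poly_Mapping.single j 1)) = 1 \<Longrightarrow>
      sgn (entry T k i * (entry T k j + Poly_Mapping.lookup v k)) = sgn (entry T k i * entry T k j)"
  shows "\<exists>A. nontrivial_uniform_BPB_approx \<epsilon> T A \<and> norm_attain T = norm_attain A"
proof -
  obtain A where dist: "norm (A - T) \<le> norm v"
    and col: "\<And>i. blinfun_apply A (Poly_Mapping.single i 1) =
      blinfun_apply T (Poly_Mapping.single i 1) + (if i = j then v else 0)"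
    using column_perturbation[of T v j] by blast
  have entry_A: "entry A k i = entry T k i + (if i = j then Poly_Mapping.lookup v k else 0)" for k i
    by (simp add: entry_def col lookup_add)
  have unit_A: "norm (blinfun_apply T (Poly_Mapping.single i 1)) = 1 \<longleftrightarrow>
      norm (blinfun_apply A (Poly_Mapping.single i 1)) = 1" for i
    by (simp add: col unit)
  have "norm (blinfun_apply A (Poly_Mapping.single i 1)) \<le> 1" for i
    using norm_column_le[of T i] T le by (simp add: col)
  then have "norm A \<le> 1" by (rule norm_le_one_columnsI)
  moreover obtain i where "norm (blinfun_apply T (Poly_Mapping.single i 1)) = 1"
    using unit_column_exists[OF T] by blast
  then have "norm A \<ge> 1"
    using unit_A[of i] norm_column_le[of A i] by simp
  ultimately have A: "norm A = 1" by simp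
  have attain: "norm_attain T = norm_attain A"
  proof (rule norm_attain_eqI[OF T A unit_A])
    fix k i i'
    assume "i \<noteq> i'" "norm (blinfun_apply T (Poly_Mapping.single i 1)) = 1"
      "norm (blinfun_apply T (Poly_Mapping.single i' 1)) = 1"
    \<comment> \<open>At most one of the two distinct columns is column \<open>j\<close>;
      \<open>sign\<close> is applied in either order.\<close>
    then show "sgn (entry T k i * entry T k i') = sgn (entry A k i * entry A k i')"
      using sign[of i k] sign[of i' k] by (auto simp: entry_A mult.commute)
  qed
  have "A \<noteq> T"
    using col[of j] \<open>v \<noteq> 0\<close> by auto
  moreover have "norm (T - A) < \<epsilon>"
    using dist \<open>norm v < \<epsilon>\<close> by (simp add: norm_minus_commute)
  ultimately show ?thesis
    using norm_attain_nearby[OF compact_sphere_l1 T \<open>\<epsilon> > 0\<close>] T A attain \<open>\<epsilon> > 0\<close>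
    by (auto simp: nontrivial_uniform_BPB_approx_def uniform_BPB_approx_def)
qed

text \<open>Row \<open>k\<close> loses less than its entry and row \<open>m\<close> grows away from
  zero, so nonzero entries keep their signs and the column norm is unchanged. If row
  \<open>m\<close> vanishes, its new entry meets only zeros in the other columns, so the products
  stay zero.\<close>

lemma nontrivial_approx_shift_mass:
  fixes T :: "'n::finite l1 \<Rightarrow>\<^sub>L 'm::finite l1"
  assumes T: "norm T = 1" and "\<epsilon> > 0"
    and unit: "norm (blinfun_apply T (Poly_Mapping.single j 1)) = 1"
    and "k \<noteq> m" and k: "entry T k j \<noteq> 0"
    and m: "entry T m j \<noteq> 0 \<or> (\<forall>i. entry T m i = 0)"
  shows "\<exists>A. nontrivial_uniform_BPB_approx \<epsilon> T A \<and> norm_attain T = norm_attain A"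
proof -
  \<comment> \<open>Half the entry preserves its sign, and \<open>\<epsilon> / 3\<close> keeps the
    total change \<open>2 * t\<close> below \<open>\<epsilon>\<close>.\<close>
  define t where "t = min (\<bar>entry T k j\<bar> / 2) (\<epsilon> / 3)"
  define s where "s = (if entry T m j < 0 then -1 else 1 :: real)"
  define v :: "'m l1"
    where "v = Poly_Mapping.single k (- t * sgn (entry T k j)) + Poly_Mapping.single m (t * s)"
  have t: "0 < t" "t < \<bar>entry T k j\<bar>" "2 * t < \<epsilon>"
    using k \<open>\<epsilon> > 0\<close> by (auto simp: t_def)
  have v: "Poly_Mapping.lookup v i =
      (if i = k then - t * sgn (entry T k j) else if i = m then t * s else 0)" for i
    using \<open>k \<noteq> m\<close> by (auto simp: v_def lookup_add lookup_single when_def)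
  have vk: "\<bar>entry T k j + Poly_Mapping.lookup v k\<bar> = \<bar>entry T k j\<bar> - t"
    "sgn (entry T k j + Poly_Mapping.lookup v k) = sgn (entry T k j)"
    using t by (auto simp: v sgn_if abs_if split: if_splits)
  have vm: "\<bar>entry T m j + Poly_Mapping.lookup v m\<bar> = \<bar>entry T m j\<bar> + t"
    "entry T m j \<noteq> 0 \<Longrightarrow> sgn (entry T m j + Poly_Mapping.lookup v m) = sgn (entry T m j)"
    using t \<open>k \<noteq> m\<close> by (auto simp: v s_def sgn_if abs_if)
  have "(\<Sum>i\<in>UNIV. \<bar>entry T i j + Poly_Mapping.lookup v i\<bar>) =
      (\<Sum>i\<in>UNIV. \<bar>entry T i j\<bar> + ((if i = m then t else 0) - (if i = k then t else 0)))"
    using vk vm \<open>k \<noteq> m\<close> by (intro sum.cong) (auto simp: v)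
  also have "\<dots> = 1"
    using unit by (simp add: norm_column sum.distrib sum_subtractf)
  finally have shifted: "norm (blinfun_apply T (Poly_Mapping.single j 1) + v) = 1"
    by (simp add: norm_l1 lookup_add entry_def)
  have "v \<noteq> 0"
    using v[of k] t k by (auto simp: sgn_eq_0_iff)
  moreover have "norm v < \<epsilon>"
  proof -
    have "norm v \<le> \<bar>- t * sgn (entry T k j)\<bar> + \<bar>t * s\<bar>"
      unfolding v_def by (rule order_trans[OF norm_triangle_ineq]) simp
    also have "\<dots> = 2 * t"
      using t k by (simp add: abs_mult s_def abs_sgn_eq)
    finally show ?thesis using t by simp
  qed
  moreover have "sgn (entry T l i * (entry T l j + Poly_Mapping.lookup v l)) =
      sgn (entry T l i * entry T l j)" for l i
    using m vk vm by (cases "l = k \<or> l = m") (auto simp: sgn_mult v)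
  ultimately show ?thesis
    using unit shifted by (intro nontrivial_approx_exists[OF T \<open>\<epsilon> > 0\<close>, of v j]) auto
qed

text \<open>A column of norm below 1 has room for a small vector in any direction and stays short;
  signs are constrained only on unit columns.\<close>

lemma nontrivial_approx_short_column:
  fixes T :: "'n::finite l1 \<Rightarrow>\<^sub>L 'm::finite l1"
  assumes T: "norm T = 1" and "\<epsilon> > 0"
    and short: "norm (blinfun_apply T (Poly_Mapping.single j 1)) < 1"
  shows "\<exists>A. nontrivial_uniform_BPB_approx \<epsilon> T A \<and> norm_attain T = norm_attain A"
proof -
  let ?c = "norm (blinfun_apply T (Poly_Mapping.single j 1))"
  define t where "t = min ((1 - ?c) / 2) (\<epsilon> / 2)"
  \<comment> \<open>Here \<open>undefined\<close> stands for an arbitrary row.\<close>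
  define v :: "'m l1" where "v = Poly_Mapping.single undefined t"
  have t: "0 < t" "?c + t < 1" "t < \<epsilon>"
    using short \<open>\<epsilon> > 0\<close> by (auto simp: t_def min_def field_simps)
  have v: "norm v = t"
    using t by (simp add: v_def)
  have "norm (blinfun_apply T (Poly_Mapping.single j 1) + v) < 1"
    using norm_triangle_ineq[of "blinfun_apply T (Poly_Mapping.single j 1)" v] v t by linarith
  then show ?thesis
    using short v t by (intro nontrivial_approx_exists[OF T \<open>\<epsilon> > 0\<close>, of v j]) auto
qed

lemma unit_column_nonzero_entry:
  fixes T :: "'n::finite l1 \<Rightarrow>\<^sub>L 'm::finite l1"
  assumes "norm (blinfun_apply T (Poly_Mapping.single j 1)) = 1"
  shows "\<exists>k. entry T k j \<noteq> 0"
proof (rule ccontr)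
  assume "\<nexists>k. entry T k j \<noteq> 0"
  then show False using assms by (simp add: norm_column)
qed

section \<open>Approximations of non-isometries\<close>

text \<open>The hypotheses describe a signed permutation matrix: \<open>\<pi>\<close> sends a column
  to the row of its only nonzero entry, is surjective because no row vanishes, and is then injective
  by finiteness.\<close>

lemma IsoI_monomial:
  fixes T :: "'n::finite l1 \<Rightarrow>\<^sub>L 'n l1"
  assumes unit: "\<And>j. norm (blinfun_apply T (Poly_Mapping.single j 1)) = 1"
    and column: "\<And>j k m. k \<noteq> m \<Longrightarrow> entry T k j \<noteq> 0 \<Longrightarrow> entry T m j = 0"
    and row: "\<And>k. \<exists>j. entry T k j \<noteq> 0"
  shows "T \<in> Iso"
proof -
  obtain \<pi> where \<pi>: "\<And>j. entry T (\<pi> j) j \<noteq> 0"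
    using unit_column_nonzero_entry[OF unit] by metis
  have zero: "entry T k j = 0" if "k \<noteq> \<pi> j" for k j
    using column[OF that[symmetric] \<pi>] .
  have "surj \<pi>"
    using row zero by (metis surj_def)
  then have "inj \<pi>"
    by (simp add: finite_UNIV_surj_inj)
  have abs_\<pi>: "\<bar>entry T (\<pi> j) j\<bar> = 1" for j
  proof -
    have "(\<Sum>k\<in>UNIV. \<bar>entry T k j\<bar>) = (\<Sum>k\<in>UNIV. if k = \<pi> j then \<bar>entry T (\<pi> j) j\<bar> else 0)"
      using zero by (intro sum.cong) auto
    then show ?thesis using unit[of j] by (simp add: norm_column)
  qed
  have row_\<pi>: "(\<Sum>i\<in>UNIV. entry T (\<pi> j) i * Poly_Mapping.lookup x i) =
      entry T (\<pi> j) j * Poly_Mapping.lookup x j" for x j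
  proof -
    have "(\<Sum>i\<in>UNIV. entry T (\<pi> j) i * Poly_Mapping.lookup x i) =
        (\<Sum>i\<in>UNIV. if i = j then entry T (\<pi> j) j * Poly_Mapping.lookup x j else 0)"
      using \<open>inj \<pi>\<close> by (intro sum.cong) (auto simp: zero inj_eq)
    then show ?thesis by simp
  qed
  have "norm (blinfun_apply T x) = norm x" for x
  proof -
    have "norm (blinfun_apply T x) =
        (\<Sum>k\<in>range \<pi>. \<bar>\<Sum>i\<in>UNIV. entry T k i * Poly_Mapping.lookup x i\<bar>)"
      using \<open>surj \<pi>\<close> by (simp add: norm_l1 lookup_blinfun_apply)
    also have "\<dots> = norm x"
      using \<open>inj \<pi>\<close> by (simp add: sum.reindex row_\<pi> abs_mult abs_\<pi> norm_l1)
    finally show ?thesis .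
  qed
  then show ?thesis by (simp add: Iso_def)
qed

lemma nontrivial_norm_preserving_approx_l1:
  fixes T :: "'n::finite l1 \<Rightarrow>\<^sub>L 'n l1"
  assumes T: "norm T = 1" and "T \<notin> Iso" and "\<epsilon> > 0"
  shows "\<exists>A. nontrivial_uniform_BPB_approx \<epsilon> T A \<and> norm_attain T = norm_attain A"
proof (cases "\<forall>j. norm (blinfun_apply T (Poly_Mapping.single j 1)) = 1")
  case False
  then obtain j where "norm (blinfun_apply T (Poly_Mapping.single j 1)) < 1"
    using norm_column_le[of T] T by (metis order_less_le)
  then show ?thesis
    by (rule nontrivial_approx_short_column[OF T \<open>\<epsilon> > 0\<close>])
next
  case unit: True
  show ?thesis
  proof (cases "\<exists>j k m. k \<noteq> m \<and> entry T k j \<noteq> 0 \<and>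
      (entry T m j \<noteq> 0 \<or> (\<forall>i. entry T m i = 0))")
    case True
    then show ?thesis
      using nontrivial_approx_shift_mass[OF T \<open>\<epsilon> > 0\<close>] unit by blast
  next
    case False
    \<comment> \<open>If row \<open>m\<close> vanished, mass could be moved into it from a nonzero
      entry of any column; \<open>undefined\<close> picks one.\<close>
    have "\<exists>i. entry T m i \<noteq> 0" for m
    proof -
      obtain k where "entry T k undefined \<noteq> 0"
        using unit_column_nonzero_entry unit by blast
      then show ?thesis
        using False by metis
    qed
    then have "T \<in> Iso"
      using unit False by (intro IsoI_monomial) metis+
    with \<open>T \<notin> Iso\<close> show ?thesis ..
  qed
qed

section \<open>Rigidity of isometries\<close>

text \<open>Density puts a norm attaining point into every open orthant. One such point has full
  support, so all columns are unit; two orthants differing only in the sign of coordinate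
  \<open>i\<close> impose opposite sign conditions on the product of entries.\<close>

lemma norm_attain_dense_disjoint_columns:
  fixes A :: "'n::finite l1 \<Rightarrow>\<^sub>L 'm::finite l1"
  assumes A: "norm A = 1"
    and dense: "\<And>x. norm x = 1 \<Longrightarrow> \<exists>u\<in>norm_attain A. norm (u - x) < 1 / CARD('n)"
  shows "norm (blinfun_apply A (Poly_Mapping.single j 1)) = 1"
    and "i \<noteq> j \<Longrightarrow> entry A k i * entry A k j = 0"
proof -
  have orthant: "\<exists>u\<in>norm_attain A. \<forall>l. u_sign l * Poly_Mapping.lookup u l > 0"
    if s: "\<And>l. \<bar>u_sign l\<bar> = 1" for u_sign :: "'n \<Rightarrow> real"
  proof -
    \<comment> \<open>All coordinates of this unit vector have modulus \<open>1 / CARD('n)\<close>,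
      so a change smaller than that alters no sign.\<close>
    obtain x :: "'n l1" where x: "Poly_Mapping.lookup x = (\<lambda>l. u_sign l / CARD('n))"
      using l1_coordinates_surj by blast
    have "norm x = 1"
      by (simp add: norm_l1 x s)
    then obtain u where u: "u \<in> norm_attain A" "norm (u - x) < 1 / CARD('n)"
      using dense by blast
    have "u_sign l * Poly_Mapping.lookup u l > 0" for l
    proof -
      have "\<bar>Poly_Mapping.lookup u l - u_sign l / CARD('n)\<bar> < 1 / CARD('n)"
        using abs_lookup_le_norm[of "u - x" l] u(2) by (simp add: lookup_minus x)
      moreover have "u_sign l = 1 \<or> u_sign l = -1"
        using s[of l] by linarith
      ultimately show ?thesis by auto
    qed
    with u show ?thesis by blast
  qed
  obtain u where u: "u \<in> norm_attain A" "\<forall>l. Poly_Mapping.lookup u l > 0"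
    using orthant[of "\<lambda>_. 1"] by auto
  then show "norm (blinfun_apply A (Poly_Mapping.single j 1)) = 1"
    by (metis norm_attain_iff[OF A] order_less_irrefl)
  assume "i \<noteq> j"
  have "\<exists>w\<in>norm_attain A. \<forall>l. (if l = i then -1 else 1) * Poly_Mapping.lookup w l > 0"
    by (rule orthant) simp
  then obtain w where w: "w \<in> norm_attain A"
    and pos: "\<And>l. (if l = i then -1 else 1) * Poly_Mapping.lookup w l > 0"
    by blast
  have wi: "Poly_Mapping.lookup w i < 0" and wj: "Poly_Mapping.lookup w j > 0"
    using pos[of i] pos[of j] \<open>i \<noteq> j\<close> by auto
  have "(entry A k i * entry A k j) * (Poly_Mapping.lookup u i * Poly_Mapping.lookup u j) \<ge> 0"
    using u norm_attain_iff[OF A, of u] by (simp add: mult_ac)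
  moreover have "(entry A k i * entry A k j) * (Poly_Mapping.lookup w i * Poly_Mapping.lookup w j) \<ge> 0"
    using w norm_attain_iff[OF A, of w] by (simp add: mult_ac)
  moreover have "Poly_Mapping.lookup u i * Poly_Mapping.lookup u j > 0"
    using u by simp
  moreover have "Poly_Mapping.lookup w i * Poly_Mapping.lookup w j < 0"
    using wi wj by (simp add: mult_neg_pos)
  ultimately show "entry A k i * entry A k j = 0"
    by (smt (verit) mult_neg_pos mult_pos_neg)
qed

text \<open>Nonzero columns with disjoint supports in a square matrix leave one row for each column,
  so the single nonzero entry of a unit column has modulus 1.\<close>

lemma norm_attain_dense_entries:
  fixes A :: "'n::finite l1 \<Rightarrow>\<^sub>L 'n l1"
  assumes A: "norm A = 1"
    and dense: "\<And>x. norm x = 1 \<Longrightarrow> \<exists>u\<in>norm_attain A. norm (u - x) < 1 / CARD('n)"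
  shows "entry A k j \<in> {-1, 0, 1}"
proof -
  note unit = norm_attain_dense_disjoint_columns(1)[OF A dense]
  note disjoint = norm_attain_dense_disjoint_columns(2)[OF A dense]
  obtain \<pi> where \<pi>: "\<And>j. entry A (\<pi> j) j \<noteq> 0"
    using unit_column_nonzero_entry[OF unit] by metis
  have "inj \<pi>"
    by (rule injI) (metis \<pi> disjoint mult_eq_0_iff)
  then have "surj \<pi>"
    by (simp add: finite_UNIV_inj_surj)
  \<comment> \<open>By surjectivity row \<open>l\<close> holds the chosen nonzero entry of some
    other column, and disjointness excludes column \<open>j\<close> from that row.\<close>
  have zero: "entry A l j = 0" if "l \<noteq> \<pi> j" for l
  proof -
    obtain i where "l = \<pi> i" using \<open>surj \<pi>\<close> by blast
    with that show ?thesis using \<pi>[of i] disjoint[of i j l] by auto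
  qed
  have "(\<Sum>l\<in>UNIV. \<bar>entry A l j\<bar>) = (\<Sum>l\<in>UNIV. if l = \<pi> j then \<bar>entry A (\<pi> j) j\<bar> else 0)"
    using zero by (intro sum.cong) auto
  then have "\<bar>entry A (\<pi> j) j\<bar> = 1"
    using unit[of j] by (simp add: norm_column)
  then show ?thesis
    using zero[of k] by (cases "k = \<pi> j") auto
qed

text \<open>Since \<open>T\<close> has norm 1 at every point of the sphere, the approximation
  condition makes \<open>norm_attain A\<close> dense at scale \<open>\<epsilon>\<close>. Both
  matrices then have integer entries, which differ by less than 1 and hence agree.\<close>

lemma approx_of_isometry_unique:
  fixes T A :: "'n::finite l1 \<Rightarrow>\<^sub>L 'n l1"
  assumes "T \<in> Iso" and approx: "uniform_BPB_approx \<epsilon> T A" and \<epsilon>: "\<epsilon> \<le> 1 / CARD('n)"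
  shows "A = T"
proof (rule entry_eqI)
  fix k j
  have T: "norm T = 1" and A: "norm A = 1" and dist: "norm (A - T) < \<epsilon>"
    using approx by (simp_all add: uniform_BPB_approx_def norm_minus_commute)
  have iso: "norm (blinfun_apply T x) = norm x" for x
    using \<open>T \<in> Iso\<close> by (simp add: Iso_def)
  have "x \<in> norm_attain T" if "norm x = 1" for x
    using that T by (simp add: norm_attain_def iso)
  then have T_dense: "\<exists>u\<in>norm_attain T. norm (u - x) < 1 / CARD('n)" if "norm x = 1" for x
    using that by (intro bexI[of _ x]) auto
  obtain \<delta> where "\<delta> > 0" and \<delta>: "\<forall>x\<in>sphere 0 1. norm (blinfun_apply T x) > 1 - \<delta> \<longrightarrow>
      (\<exists>u\<in>norm_attain A. norm (u - x) < \<epsilon>)"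
    using approx unfolding uniform_BPB_approx_def by blast
  have A_dense: "\<exists>u\<in>norm_attain A. norm (u - x) < 1 / CARD('n)" if "norm x = 1" for x
    using \<delta>[rule_format, of x] that \<open>\<delta> > 0\<close> \<epsilon> by (force simp: iso)
  have "entry A k j - entry T k j =
      Poly_Mapping.lookup (blinfun_apply (A - T) (Poly_Mapping.single j 1)) k"
    by (simp add: entry_def blinfun.diff_left lookup_minus)
  then have "\<bar>entry A k j - entry T k j\<bar> \<le> norm (A - T)"
    using abs_lookup_le_norm norm_column_le by (metis order_trans)
  also have "\<dots> < 1 / CARD('n)"
    using dist \<epsilon> by simp
  also have "\<dots> \<le> 1"
    by simp
  finally show "entry A k j = entry T k j"
    using norm_attain_dense_entries[OF A A_dense, of k j] norm_attain_dense_entries[OF T T_dense, of k j]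
    by auto
qed

section \<open>The characterization of isometries and the approximation property\<close>

theorem corollary4p6:
  shows "(\<forall>T \<in> sphere (0 :: 'n::finite l1 \<Rightarrow>\<^sub>L 'n l1) 1.
            T \<in> Iso \<longleftrightarrow>
            (\<exists>\<epsilon>\<^sub>0>0. \<forall>\<epsilon>. 0 < \<epsilon> \<and> \<epsilon> < \<epsilon>\<^sub>0 \<longrightarrow> {A. uniform_BPB_approx \<epsilon> T A} = {T}))
       \<and> nontrivial_norm_preserving_uniform_BPB_property TYPE('n l1) TYPE('n l1)"
proof (intro conjI ballI iffI)
  fix T :: "'n l1 \<Rightarrow>\<^sub>L 'n l1"
  assume "T \<in> sphere 0 1"
  then have T: "norm T = 1" by simp
  {
    assume "T \<in> Iso"
    have "{A. uniform_BPB_approx \<epsilon> T A} = {T}" if "0 < \<epsilon>" "\<epsilon> < 1 / CARD('n)" for \<epsilon>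
    proof -
      have "uniform_BPB_approx \<epsilon> T T"
        using that T norm_attain_nearby[OF compact_sphere_l1 T \<open>0 < \<epsilon>\<close>]
        by (simp add: uniform_BPB_approx_def)
      then show ?thesis
        using approx_of_isometry_unique[OF \<open>T \<in> Iso\<close>] that by fastforce
    qed
    then show "\<exists>\<epsilon>\<^sub>0>0. \<forall>\<epsilon>. 0 < \<epsilon> \<and> \<epsilon> < \<epsilon>\<^sub>0 \<longrightarrow> {A. uniform_BPB_approx \<epsilon> T A} = {T}"
      by (intro exI[of _ "1 / CARD('n)"]) auto
  next
    assume "\<exists>\<epsilon>\<^sub>0>0. \<forall>\<epsilon>. 0 < \<epsilon> \<and> \<epsilon> < \<epsilon>\<^sub>0 \<longrightarrow> {A. uniform_BPB_approx \<epsilon> T A} = {T}"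
    then obtain \<epsilon>\<^sub>0 where "\<epsilon>\<^sub>0 > 0"
      and unique: "\<And>\<epsilon>. 0 < \<epsilon> \<and> \<epsilon> < \<epsilon>\<^sub>0 \<Longrightarrow> {A. uniform_BPB_approx \<epsilon> T A} = {T}"
      by blast
    obtain \<epsilon> where "\<epsilon> > 0" "\<epsilon> < \<epsilon>\<^sub>0"
      using dense \<open>\<epsilon>\<^sub>0 > 0\<close> by blast
    then have only: "{A. uniform_BPB_approx \<epsilon> T A} = {T}"
      by (intro unique) simp
    \<comment> \<open>Otherwise there would be an approximation different from \<open>T\<close> at
      this \<open>\<epsilon>\<close>.\<close>
    show "T \<in> Iso"
      using nontrivial_norm_preserving_approx_l1[OF T _ \<open>\<epsilon> > 0\<close>] only
      by (auto simp: nontrivial_uniform_BPB_approx_def)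
  }
next
  show "nontrivial_norm_preserving_uniform_BPB_property TYPE('n l1) TYPE('n l1)"
    unfolding nontrivial_norm_preserving_uniform_BPB_property_def
    by (simp add: nontrivial_norm_preserving_approx_l1)
qed

end
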